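(* Let $k,n$ be nonnegative integers of the same parity with $n\ge k$, and put $s=\frac12(n-k)$. Then $a_{k,n}$ equals the number of pairs $(c_1,c_2)$ satisfying all of the following: $c_1$ is an ordered composition of $k+2$ with all summands at least $2$; $c_2$ is an ordered composition of $n+2$ with all summands at least $2$; and $c_2$ has exactly $s$ more summands than $c_1$.
   Context: For nonnegative integers $k,n$, let $a_{k,n}$ be the number of ways to partition a set consisting of $k$ marked points on a line and $n$ marked points on a parallel line into pairs, joining the two points of each pair by a straight segment, such that no two segments have a common point (in particular, no endpoint lies on another segment). We have $a_{0,0}=1$. A composition of $m$ is a representation of $m$ as an ordered sum of positive integers. Sums differing in the order of the summands are considered different. *)

theory Defs
  imports "HOL-Analysis.Analysis" "HOL-Library.Disjoint_Sets"
begin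

definition distinct_parallel_lines :: "(real ^ 2) set \<Rightarrow> (real ^ 2) set \<Rightarrow> bool" where
  "distinct_parallel_lines L1 L2 \<longleftrightarrow>
     affine L1 \<and> aff_dim L1 = 1 \<and> affine_parallel L1 L2 \<and> L1 \<noteq> L2"

definition pairings :: "'a set \<Rightarrow> 'a set set set" where
  "pairings P = {M. partition_on P M \<and> (\<forall>e\<in>M. card e = 2)}"

text \<open>Segments are closed, so two segments meeting in an endpoint of one of them, or overlapping
  on a common line, are excluded as well as proper crossings.\<close>

definition segments_disjoint :: "(real ^ 2) set set \<Rightarrow> bool" where
  "segments_disjoint M \<longleftrightarrow>
     (\<forall>p q p' q'. {p, q} \<in> M \<and> {p', q'} \<in> M \<and> {p, q} \<noteq> {p', q'} \<longrightarrow>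
        closed_segment p q \<inter> closed_segment p' q' = {})"

text \<open>The number \<open>a\<^bsub>k,n\<^esub>\<close> is this count for \<open>A\<close> consisting of \<open>k\<close> points on a line and \<open>B\<close>
  consisting of \<open>n\<close> points on a different line parallel to it.\<close>

definition num_disjoint_pairings :: "(real ^ 2) set \<Rightarrow> (real ^ 2) set \<Rightarrow> nat" where
  "num_disjoint_pairings A B = card {M \<in> pairings (A \<union> B). segments_disjoint M}"

definition compositions :: "nat \<Rightarrow> nat list set" where
  "compositions m = {c. (\<forall>x\<in>set c. 0 < x) \<and> sum_list c = m}"

end

theory Submission
  imports Defs
begin

text \<open>Let \<open>a\<close> and \<open>b\<close> be the last points of \<open>A\<close> and \<open>B\<close>. In a disjoint pairing, \<open>a\<close> is joined to its
  predecessor on the line, or \<open>b\<close> is joined to its predecessor, or \<open>a\<close> is joined to \<open>b\<close>, and only the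
  first two can occur together. Removing these segments and using inclusion-exclusion gives
  \<open>a\<^bsub>k,n\<^esub> + a\<^bsub>k-2,n-2\<^esub> = a\<^bsub>k-2,n\<^esub> + a\<^bsub>k,n-2\<^esub> + a\<^bsub>k-1,n-1\<^esub>\<close>. On the other side,
  let \<open>T(k, j)\<close> be the number of compositions of \<open>k + 2\<close> with parts at least \<open>2\<close> that exceed \<open>2\<close>
  by \<open>j\<close> in total. Looking at the first part, \<open>T(k, j) = T(k-2, j) + T(k-1, j-1)\<close>, so that
  \<open>\<Sum>\<^sub>j T(k, j) T(n, j)\<close> satisfies the same recurrence; here \<open>j\<close> plays the role of the number of
  segments between the two lines.\<close>

subsection \<open>Compositions with parts at least two\<close>

text \<open>The excess, the sum of all \<open>x - 2\<close>, is expressed through the length, so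
  that fixing it fixes the number of parts. The additive form avoids truncated subtraction.\<close>

definition comps_excess :: "nat \<Rightarrow> nat \<Rightarrow> nat list set" where
  "comps_excess k j = {c. (\<forall>x\<in>set c. 2 \<le> x) \<and> sum_list c = k + 2 \<and> 2 * length c + j = k + 2}"

definition num_comps_excess :: "nat \<Rightarrow> nat \<Rightarrow> nat" where
  "num_comps_excess k j = card (comps_excess k j)"

lemma finite_comps_excess: "finite (comps_excess k j)"
proof (rule finite_subset)
  show "comps_excess k j \<subseteq> {c. set c \<subseteq> {..k + 2} \<and> length c \<le> k + 2}"
    using member_le_sum_list by (fastforce simp: comps_excess_def)
  show "finite {c. set c \<subseteq> {..k + 2} \<and> length c \<le> k + 2}"
    by (rule finite_lists_length_le) simp
qed

lemma double_length_le_sum_list: "\<forall>x\<in>set c. 2 \<le> x \<Longrightarrow> 2 * length c \<le> sum_list (c :: nat list)"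
  by (induction c) auto

text \<open>The sum \<open>k + 2\<close> is positive, so there is at least one part, and it uses up
  \<open>2\<close> of the sum. At most \<open>k\<close> is left for the excess.\<close>

lemma num_comps_excess_eq_0:
  assumes "k < j"
  shows "num_comps_excess k j = 0"
proof -
  have "c \<notin> comps_excess k j" for c
  proof
    assume c: "c \<in> comps_excess k j"
    then have "0 < length c" by (auto simp: comps_excess_def)
    moreover have "2 * length c + j = k + 2" using c by (simp add: comps_excess_def)
    ultimately show False using assms by linarith
  qed
  then have "comps_excess k j = {}" by blast
  then show ?thesis by (simp add: num_comps_excess_def)
qed

lemma num_comps_excess_0:
  "num_comps_excess 0 j = (if j = 0 then 1 else 0)"
proof -
  have "c = [2]" if "c \<in> comps_excess 0 0" for c
    using that by (cases c) (auto simp: comps_excess_def)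
  moreover have "[2] \<in> comps_excess 0 0"
    by (simp add: comps_excess_def)
  ultimately have "comps_excess 0 0 = {[2]}" by blast
  then show ?thesis
    using num_comps_excess_eq_0[of 0 j] by (simp add: num_comps_excess_def)
qed

lemma num_comps_excess_1:
  "num_comps_excess 1 j = (if j = 1 then 1 else 0)"
proof -
  have "c = [3]" if c: "c \<in> comps_excess 1 1" for c
  proof -
    have "length c = 1" using c by (simp add: comps_excess_def)
    then obtain x where "c = [x]" by (auto simp: length_Suc_conv)
    then show ?thesis using c by (simp add: comps_excess_def)
  qed
  moreover have "[3] \<in> comps_excess 1 1"
    by (simp add: comps_excess_def)
  ultimately have "comps_excess 1 1 = {[3]}" by blast
  moreover have "comps_excess 1 0 = {}"
  proof -
    have "2 * length c + 0 \<noteq> 1 + 2" for c :: "nat list" by presburger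
    then show ?thesis by (simp add: comps_excess_def)
  qed
  moreover have "j = 0 \<or> j = 1 \<or> 1 < j" by linarith
  ultimately show ?thesis
    using num_comps_excess_eq_0[of 1 j] by (auto simp: num_comps_excess_def)
qed

text \<open>A first part equal to \<open>2\<close> is deleted, which keeps the excess. A larger
  first part is lowered by one, which lowers both the sum and the excess by one.\<close>

lemma num_comps_excess_step:
  "num_comps_excess (k + 2) j =
     num_comps_excess k j + (if j = 0 then 0 else num_comps_excess (k + 1) (j - 1))"
proof -
  define inc where "inc = (\<lambda>c :: nat list. Suc (hd c) # tl c)"
  \<comment> \<open>The case \<open>j = 0\<close> is split off because \<open>j - 1\<close> would be
    truncated to \<open>0\<close> there and count compositions that do not arise.\<close>
  define R where "R = (if j = 0 then {} else comps_excess (k + 1) (j - 1))"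
  have finR: "finite R" by (simp add: R_def finite_comps_excess)
  have ne: "c \<noteq> []" if "c \<in> R" for c
    using that by (auto simp: R_def comps_excess_def split: if_splits)
  have eq: "comps_excess (k + 2) j = (#) 2 ` comps_excess k j \<union> inc ` R"
  proof (intro set_eqI iffI)
    fix c assume c: "c \<in> comps_excess (k + 2) j"
    then obtain x c' where [simp]: "c = x # c'"
      by (cases c) (auto simp: comps_excess_def)
    show "c \<in> (#) 2 ` comps_excess k j \<union> inc ` R"
    proof (cases "x = 2")
      case True
      then show ?thesis using c by (auto simp: comps_excess_def)
    next
      case False
      then have x: "x \<ge> 3" using c by (auto simp: comps_excess_def)
      have "2 * length c' \<le> sum_list c'"
        using c by (intro double_length_le_sum_list) (auto simp: comps_excess_def)
      \<comment> \<open>The tail sums to at least twice its length and the first part exceeds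
        \<open>2\<close>, so the total excess is positive.\<close>
      then have "j \<noteq> 0" using c x by (auto simp: comps_excess_def)
      then have "(x - 1) # c' \<in> R"
        using c x by (auto simp: comps_excess_def R_def)
      moreover have "c = inc ((x - 1) # c')" using x by (simp add: inc_def)
      ultimately show ?thesis by blast
    qed
  next
    fix c assume "c \<in> (#) 2 ` comps_excess k j \<union> inc ` R"
    then consider c' where "c = 2 # c'" "c' \<in> comps_excess k j" | c' where "c = inc c'" "c' \<in> R"
      by blast
    then show "c \<in> comps_excess (k + 2) j"
    proof cases
      case 1
      then show ?thesis by (auto simp: comps_excess_def)
    next
      case 2
      then obtain x c'' where "c' = x # c''" using ne by (cases c') auto
      then show ?thesis using 2
        by (auto simp: comps_excess_def R_def inc_def split: if_splits)
    qed
  qed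
  have "c1 = c2" if "c1 \<in> R" "c2 \<in> R" "inc c1 = inc c2" for c1 c2
    using that ne[of c1] ne[of c2] by (cases c1; cases c2) (auto simp: inc_def)
  then have inj: "inj_on inc R" by (rule inj_onI)
  have "2 # c' \<noteq> inc c" if "c \<in> R" for c c'
  proof
    assume "2 # c' = inc c"
    then have "hd c = 1" by (simp add: inc_def)
    moreover have "hd c \<ge> 2"
      using that ne[OF that] by (auto simp: R_def comps_excess_def split: if_splits)
    ultimately show False by simp
  qed
  then have "(#) 2 ` comps_excess k j \<inter> inc ` R = {}" by blast
  then have "card (comps_excess (k + 2) j) = card (comps_excess k j) + card R"
    unfolding eq using finR
    by (subst card_Un_disjoint) (auto simp: finite_comps_excess card_image inj)
  then show ?thesis by (simp add: num_comps_excess_def R_def)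
qed

section \<open>Pairs of compositions with equal excess and their recurrence\<close>

definition num_comp_pairs :: "nat \<Rightarrow> nat \<Rightarrow> nat" where
  "num_comp_pairs k n = (\<Sum>j\<le>k. num_comps_excess k j * num_comps_excess n j)"

text \<open>All terms with \<open>j\<close> above \<open>k\<close> vanish, so any larger bound gives
  the same sum. A common bound then makes the asymmetric definition symmetric and lets different
  sums be combined termwise.\<close>

lemma num_comp_pairs_eq_sum:
  assumes "k \<le> J"
  shows "num_comp_pairs k n = (\<Sum>j\<le>J. num_comps_excess k j * num_comps_excess n j)"
  unfolding num_comp_pairs_def using assms
  by (intro sum.mono_neutral_left) (auto simp: num_comps_excess_eq_0)

lemma num_comp_pairs_commute: "num_comp_pairs k n = num_comp_pairs n k"
  using num_comp_pairs_eq_sum[of k "max k n" n] num_comp_pairs_eq_sum[of n "max k n" k]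
  by (simp add: mult.commute)

lemma num_comp_pairs_0: "num_comp_pairs 0 n = num_comps_excess n 0"
  by (simp add: num_comp_pairs_def num_comps_excess_0)

text \<open>Excess \<open>0\<close> leaves only compositions with all parts \<open>2\<close>. This
  is the form the recurrence takes when one of the lines carries no points.\<close>

lemma num_comp_pairs_0_step:
  assumes "0 < n"
  shows "num_comp_pairs 0 n = (if n < 2 then 0 else num_comp_pairs 0 (n - 2))"
proof (cases "n < 2")
  case True
  then have "n = 1" using assms by simp
  then show ?thesis using num_comps_excess_1 by (simp add: num_comp_pairs_0)
next
  case False
  then obtain m where "n = m + 2" by (metis add.commute le_Suc_ex not_less)
  then show ?thesis using num_comps_excess_step[of m 0] by (simp add: num_comp_pairs_0)
qed

text \<open>Split \<open>T\<close> as \<open>D + U\<close>, where \<open>D\<close> counts the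
  compositions with first part \<open>2\<close> and \<open>U\<close> the others. Expanding the
  products for \<open>k\<close> and \<open>n\<close> gives the identity for each \<open>j\<close>.
  The term to be subtracted stands on the left to remain within the natural numbers.\<close>

lemma num_comp_pairs_step:
  assumes "0 < k" "0 < n"
  shows "num_comp_pairs k n + (if k < 2 \<or> n < 2 then 0 else num_comp_pairs (k - 2) (n - 2)) =
    (if k < 2 then 0 else num_comp_pairs (k - 2) n) +
    (if n < 2 then 0 else num_comp_pairs k (n - 2)) + num_comp_pairs (k - 1) (n - 1)"
proof -
  define T where "T = num_comps_excess"
  define D where "D k j = (if k < 2 then 0 else T (k - 2) j)" for k j
  define U where "U k j = (if j = 0 then 0 else T (k - 1) (j - 1))" for k j
  \<comment> \<open>The splitting also holds for \<open>k = 1\<close>: there \<open>D\<close> is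
    \<open>0\<close>, and the only composition, \<open>[3]\<close>, arises from \<open>[2]\<close>
    by raising its first part.\<close>
  have T: "T k j = D k j + U k j" if k: "0 < k" for k j
  proof (cases "k < 2")
    case True
    then have "k = 1" using k by simp
    then show ?thesis
      using num_comps_excess_1[of j] num_comps_excess_0[of "j - 1"]
      by (auto simp: T_def D_def U_def)
  next
    case False
    then obtain m where "k = m + 2" by (metis add.commute le_Suc_ex not_less)
    then show ?thesis
      using num_comps_excess_step[of m j] by (simp add: T_def D_def U_def)
  qed
  have W: "num_comp_pairs k' n' = (\<Sum>j\<le>k. T k' j * T n' j)" if "k' \<le> k" for k' n'
    using num_comp_pairs_eq_sum[OF that] by (simp add: T_def)
  \<comment> \<open>Writing \<open>k\<close> as a successor permits an index shift; the term for
    \<open>j = 0\<close> vanishes by the definition of \<open>U\<close>.\<close>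
  have "(\<Sum>j\<le>k. U k j * U n j) = (\<Sum>j\<le>Suc (k - 1). U k j * U n j)"
    using assms by simp
  also have "\<dots> = num_comp_pairs (k - 1) (n - 1)"
    by (subst sum.atMost_Suc_shift) (simp add: U_def num_comp_pairs_def T_def)
  finally have UU: "num_comp_pairs (k - 1) (n - 1) = (\<Sum>j\<le>k. U k j * U n j)" ..
  have DD: "(if k < 2 \<or> n < 2 then 0 else num_comp_pairs (k - 2) (n - 2)) = (\<Sum>j\<le>k. D k j * D n j)"
    by (simp add: D_def W)
  have DT: "(if k < 2 then 0 else num_comp_pairs (k - 2) n) = (\<Sum>j\<le>k. D k j * T n j)"
    by (simp add: D_def W)
  have TD: "(if n < 2 then 0 else num_comp_pairs k (n - 2)) = (\<Sum>j\<le>k. T k j * D n j)"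
    by (simp add: D_def W)
  have "T k j * T n j + D k j * D n j = D k j * T n j + T k j * D n j + U k j * U n j" for j
    by (simp add: T assms algebra_simps)
  then show ?thesis
    unfolding UU DD DT TD W[of k n, OF order.refl] by (simp add: sum.distrib[symmetric])
qed

text \<open>Since \<open>n - k = 2 * s\<close>, having \<open>s\<close> more parts in
  \<open>c2\<close> than in \<open>c1\<close> means precisely that both compositions have the same
  excess. Grouping the pairs by this excess gives the sum.\<close>

lemma card_comp_pairs:
  fixes k n s :: nat
  assumes "n = k + 2 * s"
  shows "card {(c1, c2). c1 \<in> compositions (k + 2) \<and> (\<forall>x\<in>set c1. 2 \<le> x) \<and>
                    c2 \<in> compositions (n + 2) \<and> (\<forall>x\<in>set c2. 2 \<le> x) \<and>
                    length c2 = length c1 + s} = num_comp_pairs k n"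
    (is "card ?S = _")
proof -
  have pos: "\<forall>x\<in>set c. 0 < x" if "\<forall>x\<in>set c. 2 \<le> x" for c :: "nat list"
    using that by (metis less_le_trans zero_less_numeral)
  have eq: "?S = (\<Union>j\<in>{..k + 2}. comps_excess k j \<times> comps_excess n j)"
  proof (intro set_eqI iffI)
    fix c assume c: "c \<in> ?S"
    obtain c1 c2 where [simp]: "c = (c1, c2)" by (cases c)
    have "2 * length c1 \<le> k + 2"
      using c double_length_le_sum_list[of c1] by (auto simp: compositions_def)
    then have "c \<in> comps_excess k (k + 2 - 2 * length c1) \<times> comps_excess n (k + 2 - 2 * length c1)"
      using c assms by (auto simp: compositions_def comps_excess_def)
    then show "c \<in> (\<Union>j\<in>{..k + 2}. comps_excess k j \<times> comps_excess n j)" by fastforce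
  next
    fix c assume "c \<in> (\<Union>j\<in>{..k + 2}. comps_excess k j \<times> comps_excess n j)"
    then show "c \<in> ?S"
      using assms by (auto simp: compositions_def comps_excess_def intro!: pos)
  qed
  have "card ?S = (\<Sum>j\<le>k + 2. card (comps_excess k j \<times> comps_excess n j))"
    unfolding eq
  proof (rule card_UN_disjoint)
    show "\<forall>i\<in>{..k + 2}. \<forall>j\<in>{..k + 2}. i \<noteq> j \<longrightarrow>
        comps_excess k i \<times> comps_excess n i \<inter> comps_excess k j \<times> comps_excess n j = {}"
      by (auto simp: comps_excess_def)
  qed (simp_all add: finite_comps_excess)
  also have "\<dots> = num_comp_pairs k n"
    using num_comp_pairs_eq_sum[of k "k + 2" n] by (simp add: num_comps_excess_def card_cartesian_product)
  finally show ?thesis .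
qed

subsection \<open>Pairings\<close>

definition disjoint_pairings :: "(real ^ 2) set \<Rightarrow> (real ^ 2) set set set" where
  "disjoint_pairings P = {M \<in> pairings P. segments_disjoint M}"

lemma finite_disjoint_pairings:
  assumes "finite P"
  shows "finite (disjoint_pairings P)"
proof (rule finite_subset)
  show "disjoint_pairings P \<subseteq> Pow (Pow P)"
    by (auto simp: disjoint_pairings_def pairings_def partition_on_def)
qed (use assms in simp)

lemma disjoint_pairings_empty: "disjoint_pairings {} = {{}}"
  by (auto simp: disjoint_pairings_def pairings_def segments_disjoint_def partition_on_empty)

lemma disjoint_pairings_mem:
  assumes "M \<in> disjoint_pairings P" "{p, q} \<in> M"
  shows "p \<noteq> q" "p \<in> P" "q \<in> P"
  using assms by (auto simp: disjoint_pairings_def pairings_def partition_on_def)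

lemma partner_exists:
  assumes "M \<in> disjoint_pairings P" "p \<in> P"
  obtains q where "{p, q} \<in> M"
proof -
  obtain e where e: "e \<in> M" "p \<in> e"
    using assms by (auto simp: disjoint_pairings_def pairings_def partition_on_def)
  then have "card e = 2" using assms by (auto simp: disjoint_pairings_def pairings_def)
  then obtain q where "e = {p, q}"
    using e by (auto simp: card_2_iff)
  then show thesis using e that by blast
qed

lemma partner_unique:
  assumes "M \<in> disjoint_pairings P" "{p, q} \<in> M" "{p, r} \<in> M"
  shows "q = r"
proof -
  have "disjoint M"
    using assms by (simp add: disjoint_pairings_def pairings_def partition_on_def)
  then have "{p, q} = {p, r}"
    using disjointD[of M "{p, q}" "{p, r}"] assms by auto
  then show ?thesis by (auto simp: doubleton_eq_iff)
qed

lemma disjoint_pairings_segments: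
  assumes "M \<in> disjoint_pairings P" "{p, q} \<in> M" "{p', q'} \<in> M" "{p, q} \<noteq> {p', q'}"
  shows "closed_segment p q \<inter> closed_segment p' q' = {}"
  using assms by (auto simp: disjoint_pairings_def segments_disjoint_def)

text \<open>The point \<open>r\<close> is an endpoint of another segment of the pairing, which must
  avoid the segment from \<open>p\<close> to \<open>q\<close>.\<close>

lemma point_notin_segment:
  assumes "M \<in> disjoint_pairings P" "{p, q} \<in> M" "r \<in> P" "r \<noteq> p" "r \<noteq> q"
  shows "r \<notin> closed_segment p q"
proof -
  obtain s where "{r, s} \<in> M" using assms partner_exists by metis
  moreover have "{p, q} \<noteq> {r, s}" using assms by (auto simp: doubleton_eq_iff)
  ultimately show ?thesis using disjoint_pairings_segments[of M P p q r s] assms by auto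
qed

lemma inj_on_insert_pair: "inj_on (insert {p, q}) (disjoint_pairings (P - {p, q}))"
proof (rule inj_onI)
  fix M N
  assume "M \<in> disjoint_pairings (P - {p, q})" "N \<in> disjoint_pairings (P - {p, q})"
  then have "{p, q} \<notin> M" "{p, q} \<notin> N"
    by (auto dest: disjoint_pairings_mem(2))
  then show "insert {p, q} M = insert {p, q} N \<Longrightarrow> M = N" by (simp add: insert_ident)
qed

text \<open>By \<open>sep\<close>, the segment from \<open>p\<close> to \<open>q\<close> meets no
  segment between remaining points, so it can be added to every disjoint pairing of the rest.
  Counting pairings that contain it thus reduces to a smaller point set.\<close>

lemma disjoint_pairings_with_pair:
  assumes pq: "p \<in> P" "q \<in> P" "p \<noteq> q"
    and sep: "\<And>x y. x \<in> P - {p, q} \<Longrightarrow> y \<in> P - {p, q} \<Longrightarrow>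
                closed_segment x y \<inter> closed_segment p q = {}"
  shows "{M \<in> disjoint_pairings P. {p, q} \<in> M} = insert {p, q} ` disjoint_pairings (P - {p, q})"
proof (intro set_eqI iffI)
  fix M assume "M \<in> {M \<in> disjoint_pairings P. {p, q} \<in> M}"
  then have M: "M \<in> disjoint_pairings P" and e: "{p, q} \<in> M" by auto
  have part: "partition_on P M" using M by (simp add: disjoint_pairings_def pairings_def)
  have disj: "p \<notin> e' \<and> q \<notin> e'" if "e' \<in> M" "e' \<noteq> {p, q}" for e'
    using part e that disjointD[of M e' "{p, q}"] by (auto simp: partition_on_def)
  have "partition_on (P - {p, q}) (M - {{p, q}})"
  proof (rule partition_onI)
    show "\<Union>(M - {{p, q}}) = P - {p, q}"
    proof (intro set_eqI iffI)
      fix x assume "x \<in> P - {p, q}"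
      then obtain e' where "e' \<in> M" "x \<in> e'" "x \<noteq> p" "x \<noteq> q"
        using part by (auto simp: partition_on_def)
      then show "x \<in> \<Union>(M - {{p, q}})" by auto
    qed (use part disj in \<open>auto simp: partition_on_def\<close>)
  qed (use part in \<open>auto simp: partition_on_def disjoint_def disjnt_def\<close>)
  then have "M - {{p, q}} \<in> disjoint_pairings (P - {p, q})"
    using M by (auto simp: disjoint_pairings_def pairings_def segments_disjoint_def)
  moreover have "M = insert {p, q} (M - {{p, q}})" using e by blast
  ultimately show "M \<in> insert {p, q} ` disjoint_pairings (P - {p, q})" by blast
next
  fix M assume "M \<in> insert {p, q} ` disjoint_pairings (P - {p, q})"
  then obtain N where N: "N \<in> disjoint_pairings (P - {p, q})" and M: "M = insert {p, q} N" by blast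
  have part: "partition_on (P - {p, q}) N" using N by (simp add: disjoint_pairings_def pairings_def)
  have "partition_on P M"
    unfolding M
  proof (rule partition_onI)
    show "\<Union>(insert {p, q} N) = P"
      using part pq unfolding partition_on_def by auto
    have "disjnt x {p, q}" if "x \<in> N" for x
      using part that by (auto simp: partition_on_def disjnt_def)
    moreover have "disjnt x y" if "x \<in> N" "y \<in> N" "x \<noteq> y" for x y
      using part that disjointD[of N x y] by (auto simp: partition_on_def disjnt_def)
    ultimately show "disjnt x y"
      if "x \<in> insert {p, q} N" "y \<in> insert {p, q} N" "x \<noteq> y" for x y
      using that by (metis disjnt_sym insertE)
  qed (use part in \<open>auto simp: partition_on_def\<close>)
  then have "M \<in> pairings P"
    using N pq by (auto simp: M disjoint_pairings_def pairings_def)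
  moreover have "segments_disjoint M"
    unfolding segments_disjoint_def
  proof (intro allI impI, elim conjE)
    fix x y x' y'
    assume xy: "{x, y} \<in> M" "{x', y'} \<in> M" "{x, y} \<noteq> {x', y'}"
    \<comment> \<open>Pairs are unordered, so \<open>x\<close> and \<open>y\<close> may be
      \<open>p\<close> and \<open>q\<close> in either order.\<close>
    have seg: "closed_segment x y = closed_segment p q" if "{x, y} = {p, q}" for x y
      using that by (auto simp: doubleton_eq_iff closed_segment_commute)
    consider "{x, y} \<in> N" "{x', y'} \<in> N" | "{x, y} \<in> N" "{x', y'} = {p, q}"
      | "{x, y} = {p, q}" "{x', y'} \<in> N"
      using xy by (auto simp: M)
    then show "closed_segment x y \<inter> closed_segment x' y' = {}"
    proof cases
      case 1
      then show ?thesis using disjoint_pairings_segments[OF N] xy by blast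
    next
      case 2
      then show ?thesis using disjoint_pairings_mem[OF N] seg sep by metis
    next
      case 3
      then show ?thesis using disjoint_pairings_mem[OF N] seg sep by (metis inf_commute)
    qed
  qed
  ultimately show "M \<in> {M \<in> disjoint_pairings P. {p, q} \<in> M}"
    by (simp add: disjoint_pairings_def M)
qed

text \<open>A linear functional maps a segment into the interval between its endpoint values. Here
  one interval lies below \<open>c\<close> and the other does not reach below
  \<open>c\<close>.\<close>

lemma segments_separated:
  assumes "linear \<phi>" "\<phi> x < (c :: real)" "\<phi> y < c" "c \<le> \<phi> p" "c \<le> \<phi> q"
  shows "closed_segment x y \<inter> closed_segment p q = {}"
proof -
  have img: "\<phi> z \<in> closed_segment (\<phi> r) (\<phi> s)" if "z \<in> closed_segment r s" for r s z
    unfolding closed_segment_linear_image[OF assms(1)] using that by (rule imageI)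
  have False if "z \<in> closed_segment x y" "z \<in> closed_segment p q" for z
    using img[OF that(1)] img[OF that(2)] assms(2-5)
    by (simp add: closed_segment_eq_real_ivl split: if_splits)
  then show ?thesis by blast
qed

subsection \<open>Two parallel lines\<close>

text \<open>\<open>h\<close> is the position along the lines and \<open>v\<close> the height, which is constant on each line.\<close>

locale line_coordinates =
  fixes h v :: "real ^ 2 \<Rightarrow> real"
  assumes linear_h: "linear h" and linear_v: "linear v"
    and coord_eqI: "h x = h y \<Longrightarrow> v x = v y \<Longrightarrow> x = y"
begin

text \<open>Some point \<open>w\<close> of the segment has the same \<open>h\<close> as
  \<open>z\<close>. As \<open>v\<close> is constant on the segment, \<open>w\<close> and
  \<open>z\<close> agree in both coordinates.\<close>

lemma between_in_segment:
  assumes "v x = v z" "v y = v z" "h x \<le> h z" "h z \<le> h y"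
  shows "z \<in> closed_segment x y"
proof -
  have "h z \<in> closed_segment (h x) (h y)"
    using assms by (simp add: closed_segment_eq_real_ivl)
  then have "h z \<in> h ` closed_segment x y"
    by (simp add: closed_segment_linear_image[OF linear_h])
  then obtain w where w: "w \<in> closed_segment x y" "h w = h z" by auto
  have "v w \<in> closed_segment (v x) (v y)"
    unfolding closed_segment_linear_image[OF linear_v] using w by simp
  then have "v w = v z" using assms by simp
  then show ?thesis using w coord_eqI by metis
qed

text \<open>The endpoints occur in opposite orders on the two lines. At equal parameter both
  segments have equal height, and their difference in \<open>h\<close> changes from nonnegative to
  nonpositive.\<close>

lemma segments_cross:
  assumes "v a = v a'" "v b = v b'" "h a' \<le> h a" "h b \<le> h b'"
  shows "closed_segment a b \<inter> closed_segment a' b' \<noteq> {}"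
proof -
  define d where "d = (h a - h a') + (h b' - h b)"
  \<comment> \<open>This is the zero of the affine difference in \<open>h\<close>. If
    \<open>d = 0\<close>, the difference vanishes throughout and any parameter would do.\<close>
  define t where "t = (if d = 0 then 0 else (h a - h a') / d)"
  have d: "0 \<le> h a - h a'" "0 \<le> h b' - h b" using assms by auto
  have t: "0 \<le> t" "t \<le> 1"
    using d by (auto simp: t_def d_def divide_simps)
  have td: "t * d = h a - h a'"
    using d by (auto simp: t_def d_def)
  let ?z = "(1 - t) *\<^sub>R a + t *\<^sub>R b" and ?w = "(1 - t) *\<^sub>R a' + t *\<^sub>R b'"
  have "h ?z = h ?w"
    unfolding linear_add[OF linear_h] linear_cmul[OF linear_h]
    using td by (simp add: d_def algebra_simps)
  moreover have "v ?z = v ?w"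
    using assms by (simp add: linear_add[OF linear_v] linear_cmul[OF linear_v])
  ultimately have "?z = ?w" by (rule coord_eqI)
  moreover have "?z \<in> closed_segment a b" "?w \<in> closed_segment a' b'"
    using t by (auto simp: closed_segment_def)
  ultimately show ?thesis by auto
qed

section \<open>Last points on the lines and their partners\<close>

definition rightmost :: "(real ^ 2) set \<Rightarrow> real ^ 2 \<Rightarrow> bool" where
  "rightmost A a \<longleftrightarrow> a \<in> A \<and> (\<forall>x\<in>A - {a}. h x < h a)"

text \<open>On a line of constant \<open>v\<close> the coordinate \<open>h\<close> is injective, so
  a maximum of \<open>h\<close> is strict.\<close>

lemma rightmost_exists:
  assumes "finite A" "A \<noteq> {}" "A \<subseteq> {x. v x = c}"
  obtains a where "rightmost A a"
proof -
  have "Max (h ` A) \<in> h ` A" using assms(1,2) by simp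
  then obtain a where "a \<in> A" "Max (h ` A) = h a" by (rule imageE)
  then have a: "a \<in> A" "\<forall>x\<in>A. h x \<le> h a"
    using assms(1) Max_ge[of "h ` A"] by auto
  have "h x < h a" if "x \<in> A - {a}" for x
  proof -
    have "v x = v a" "h x \<le> h a" "x \<noteq> a" using that a assms(3) by auto
    then show ?thesis using coord_eqI[of x a] by linarith
  qed
  then show thesis using that a by (auto simp: rightmost_def)
qed

text \<open>These are the functionals used for separation: on each line they order points as
  \<open>h\<close> does, while \<open>l\<close> shifts the two lines against each other.\<close>

lemma linear_shear: "linear (\<lambda>z. h z - l * v z)"
  by (rule linearI) (simp_all add: linear_add[OF linear_h] linear_add[OF linear_v]
      linear_cmul[OF linear_h] linear_cmul[OF linear_v] algebra_simps)

lemma rightmost_cross_separated: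
  assumes "A \<subseteq> {x. v x = c}" "B \<subseteq> {x. v x = d}" "c \<noteq> d" "rightmost A a" "rightmost B b"
    and "x \<in> A \<union> B - {a, b}" "y \<in> A \<union> B - {a, b}"
  shows "closed_segment x y \<inter> closed_segment a b = {}"
proof -
  \<comment> \<open>With this slope \<open>a\<close> and \<open>b\<close> get the same sheared
    position, and every other point lies strictly to the left of it.\<close>
  define l where "l = (h b - h a) / (d - c)"
  have l: "l * (d - c) = h b - h a" using assms by (simp add: l_def)
  have v: "v a = c" "v b = d" using assms by (auto simp: rightmost_def)
  then have eq: "h a - l * v a = h b - l * v b"
    using l by (simp add: algebra_simps)
  have less: "h z - l * v z < h a - l * v a" if "z \<in> A \<union> B - {a, b}" for z
  proof (cases "z \<in> A")
    case True
    then have "h z < h a" "v z = v a" using that assms v by (auto simp: rightmost_def)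
    then show ?thesis by simp
  next
    case False
    then have "h z < h b" "v z = v b" using that assms v by (auto simp: rightmost_def)
    then show ?thesis using eq by simp
  qed
  show ?thesis
    using segments_separated[OF linear_shear less less] assms(6,7) eq by simp
qed

lemma rightmost_two_separated:
  assumes "finite B" "A \<subseteq> {x. v x = c}" "B \<subseteq> {x. v x = d}" "c \<noteq> d"
    and "rightmost A a" "rightmost (A - {a}) a'"
    and "x \<in> A \<union> B - {a, a'}" "y \<in> A \<union> B - {a, a'}"
  shows "closed_segment x y \<inter> closed_segment a a' = {}"
proof -
  text \<open>A sufficiently strong shear moves all of \<open>B\<close> to the left of \<open>a'\<close>.\<close>
  obtain K where K: "\<forall>z\<in>B. h z < K"
  proof -
    obtain K where "\<forall>z\<in>B. h z \<le> K"
      using bdd_above_finite[of "h ` B"] assms(1) by (auto simp: bdd_above_def)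
    then have "\<forall>z\<in>B. h z < K + 1" by fastforce
    then show thesis by (rule that)
  qed
  \<comment> \<open>With this slope a point at height \<open>d\<close> and position \<open>K\<close>
    is level with \<open>a'\<close>, so all of \<open>B\<close> falls below that level.\<close>
  define l where "l = (K - h a') / (d - c)"
  have l: "l * (d - c) = K - h a'" using assms by (simp add: l_def)
  have v: "v a = c" "v a' = c" and a: "h a' < h a" using assms by (auto simp: rightmost_def)
  have less: "h z - l * v z < h a' - l * v a'" if "z \<in> A \<union> B - {a, a'}" for z
  proof (cases "z \<in> A")
    case True
    then have "h z < h a'" "v z = v a'" using that assms v by (auto simp: rightmost_def)
    then show ?thesis by simp
  next
    case False
    then have "h z < K" "v z = d" using that assms K by auto
    then show ?thesis using l v by (simp add: algebra_simps)
  qed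
  show ?thesis
    using segments_separated[OF linear_shear less less] assms(7,8) a v by simp
qed

text \<open>A segment from \<open>a\<close> to a point of \<open>A\<close> beyond \<open>a'\<close>
  would contain \<open>a'\<close>, itself a point to be paired.\<close>

lemma rightmost_partner:
  assumes "A \<subseteq> {x. v x = c}" "M \<in> disjoint_pairings (A \<union> B)"
    and "rightmost A a" "rightmost (A - {a}) a'" "{a, x} \<in> M" "x \<in> A"
  shows "x = a'"
proof (rule ccontr)
  assume "x \<noteq> a'"
  moreover have "x \<noteq> a" using disjoint_pairings_mem[OF assms(2,5)] by simp
  ultimately have "h x < h a'" "h a' < h a" "a' \<in> A" "a' \<noteq> a"
    using assms by (auto simp: rightmost_def)
  moreover have "v x = v a'" "v a = v a'" using assms by (auto simp: rightmost_def)
  ultimately have "a' \<in> closed_segment a x"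
    using between_in_segment[of x a' a] by (simp add: closed_segment_commute)
  then show False
    using point_notin_segment[OF assms(2,5)] \<open>a' \<in> A\<close> \<open>a' \<noteq> a\<close> \<open>x \<noteq> a'\<close> by blast
qed

text \<open>The partner of \<open>a\<close> within \<open>A\<close> must be its predecessor, and
  this segment separates from everything else. The result is an equation of sets, not of cardinals,
  because it also serves to describe the intersection with the analogous class for the other
  line.\<close>

lemma rightmost_within:
  assumes "finite A" "finite B" "A \<subseteq> {x. v x = c}" "B \<subseteq> {x. v x = d}" "c \<noteq> d" "rightmost A a"
    and "2 \<le> card A"
  obtains a' where "a' \<in> A" "a' \<noteq> a"
    "{M \<in> disjoint_pairings (A \<union> B). \<exists>x\<in>A. {a, x} \<in> M} =
       insert {a, a'} ` disjoint_pairings (A - {a, a'} \<union> B)"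
proof -
  have aA: "a \<in> A" using assms by (simp add: rightmost_def)
  have "A - {a} \<noteq> {}"
  proof
    assume "A - {a} = {}"
    then have "A = {a}" using aA by blast
    then show False using assms by simp
  qed
  moreover have "A - {a} \<subseteq> {x. v x = c}" using assms by blast
  ultimately obtain a' where a': "rightmost (A - {a}) a'"
    using rightmost_exists[of "A - {a}" c] assms(1) by auto
  then have mem: "a' \<in> A" "a' \<noteq> a" by (auto simp: rightmost_def)
  have "A \<inter> B = {}" using assms by auto
  then have P: "A \<union> B - {a, a'} = A - {a, a'} \<union> B" using mem aA by blast
  have "{M \<in> disjoint_pairings (A \<union> B). \<exists>x\<in>A. {a, x} \<in> M} =
      {M \<in> disjoint_pairings (A \<union> B). {a, a'} \<in> M}"
    using rightmost_partner[OF assms(3) _ assms(6) a'] mem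
    by (intro Collect_cong conj_cong refl) metis
  also have "\<dots> = insert {a, a'} ` disjoint_pairings (A \<union> B - {a, a'})"
    using aA mem rightmost_two_separated[OF assms(2-6) a']
    by (intro disjoint_pairings_with_pair) auto
  finally show thesis using that mem P by simp
qed

text \<open>The function \<open>F\<close> stands for the count as a function of the size of
  \<open>A'\<close> with \<open>B\<close> fixed. An induction hypothesis can thus be supplied for
  either line, and also after two points of the other line have been removed.\<close>

lemma card_rightmost_within:
  assumes "finite A" "finite B" "A \<subseteq> {x. v x = c}" "B \<subseteq> {x. v x = d}" "c \<noteq> d" "rightmost A a"
    and F: "\<And>A'. A' \<subset> A \<Longrightarrow> card (disjoint_pairings (A' \<union> B)) = F (card A')"
  shows "card {M \<in> disjoint_pairings (A \<union> B). \<exists>x\<in>A. {a, x} \<in> M} =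
           (if card A < 2 then 0 else F (card A - 2))"
proof (cases "card A < 2")
  case True
  moreover have aA: "a \<in> A" using assms by (simp add: rightmost_def)
  moreover from aA assms(1) have "card A \<noteq> 0" by auto
  ultimately have "card A = 1" by linarith
  then have "A = {a}" using aA by (auto simp: card_1_singleton_iff)
  then have "{a, x} \<notin> M" if "M \<in> disjoint_pairings (A \<union> B)" "x \<in> A" for M x
    using disjoint_pairings_mem(1)[OF that(1), of a x] that(2) by auto
  then have "{M \<in> disjoint_pairings (A \<union> B). \<exists>x\<in>A. {a, x} \<in> M} = {}"
    by blast
  then show ?thesis using True by (simp only: card.empty if_True)
next
  case False
  have aA: "a \<in> A" using assms by (simp add: rightmost_def)
  obtain a' where a': "a' \<in> A" "a' \<noteq> a"
    "{M \<in> disjoint_pairings (A \<union> B). \<exists>x\<in>A. {a, x} \<in> M} =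
       insert {a, a'} ` disjoint_pairings (A - {a, a'} \<union> B)"
    using rightmost_within[OF assms(1-6) leI[OF False]] .
  have "A \<inter> B = {}" using assms by auto
  then have P: "A - {a, a'} \<union> B = A \<union> B - {a, a'}" using a' aA by blast
  have "card (A - {a, a'}) = card A - 2"
    using a' aA assms(1) by (simp add: card_Diff_subset)
  moreover have "A - {a, a'} \<subset> A" using aA by blast
  ultimately show ?thesis
    using False inj_on_insert_pair[of a a' "A \<union> B"] F[of "A - {a, a'}"]
    by (simp add: a'(3) P card_image)
qed

section \<open>The recurrence for disjoint pairings, by induction on the number of points\<close>

lemma card_disjoint_pairings:
  assumes "finite A" "finite B" "A \<subseteq> {x. v x = c}" "B \<subseteq> {x. v x = d}" "c \<noteq> d"
  shows "card (disjoint_pairings (A \<union> B)) = num_comp_pairs (card A) (card B)"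
  using assms
proof (induction "card A + card B" arbitrary: A B rule: less_induct)
  case less
  note fin = less.prems(1,2) and lines = less.prems(3-5)
  have IH: "card (disjoint_pairings (A' \<union> B')) = num_comp_pairs (card A') (card B')"
    if "A' \<subseteq> A" "B' \<subseteq> B" "A' \<noteq> A \<or> B' \<noteq> B" for A' B'
  proof (rule less.hyps)
    have "card A' \<le> card A" "card B' \<le> card B" using that fin by (auto intro: card_mono)
    moreover have "card A' < card A \<or> card B' < card B"
      using that fin by (metis psubset_card_mono psubsetI)
    ultimately show "card A' + card B' < card A + card B" by linarith
    show "finite A'" "finite B'" using that fin finite_subset by auto
    show "A' \<subseteq> {x. v x = c}" "B' \<subseteq> {x. v x = d}" using that lines by auto
  qed (rule lines(3))
  have disj: "A \<inter> B = {}" using lines by auto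
  let ?S = "disjoint_pairings (A \<union> B)"
  have finS: "finite ?S" using fin by (simp add: finite_disjoint_pairings)
  let ?SA = "\<lambda>a. {M \<in> ?S. \<exists>x\<in>A. {a, x} \<in> M}"
  let ?SB = "\<lambda>b. {M \<in> ?S. \<exists>x\<in>B. {b, x} \<in> M}"
  have SA: "card (?SA a) = (if card A < 2 then 0 else num_comp_pairs (card A - 2) (card B))"
    if "rightmost A a" for a
    by (rule card_rightmost_within[OF fin lines that]) (use IH in auto)
  have SB: "card (?SB b) = (if card B < 2 then 0 else num_comp_pairs (card A) (card B - 2))"
    if "rightmost B b" for b
    using card_rightmost_within[OF fin(2,1) lines(2,1) lines(3)[symmetric] that,
        of "num_comp_pairs (card A)"] IH[of A] by (simp add: Un_commute psubset_eq)
  consider "A = {}" "B = {}" | "A = {}" "B \<noteq> {}" | "A \<noteq> {}" "B = {}" | "A \<noteq> {}" "B \<noteq> {}"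
    by blast
  then show ?case
  proof cases
    case 1
    then show ?thesis
      by (simp add: disjoint_pairings_empty num_comp_pairs_0 num_comps_excess_0)
  next
    case 2
    obtain b where b: "rightmost B b" using rightmost_exists[OF fin(2) 2(2) lines(2)] .
    \<comment> \<open>With \<open>A\<close> empty, the partner of \<open>b\<close> necessarily lies
      in \<open>B\<close>.\<close>
    have "?S = ?SB b"
    proof (intro set_eqI iffI)
      fix M assume M: "M \<in> ?S"
      obtain y where "{b, y} \<in> M"
        using partner_exists[OF M] b by (auto simp: rightmost_def)
      then show "M \<in> ?SB b" using disjoint_pairings_mem[OF M] 2 M by blast
    qed simp
    then show ?thesis
      using SB[OF b] num_comp_pairs_0_step[of "card B"] 2 fin by (simp add: card_gt_0_iff)
  next
    case 3
    obtain a where a: "rightmost A a" using rightmost_exists[OF fin(1) 3(1) lines(1)] .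
    have "?S = ?SA a"
    proof (intro set_eqI iffI)
      fix M assume M: "M \<in> ?S"
      obtain y where "{a, y} \<in> M"
        using partner_exists[OF M] a by (auto simp: rightmost_def)
      then show "M \<in> ?SA a" using disjoint_pairings_mem[OF M] 3 M by blast
    qed simp
    then show ?thesis
      using SA[OF a] num_comp_pairs_0_step[of "card A"] 3 fin
      by (simp add: card_gt_0_iff num_comp_pairs_commute[of _ 0])
  next
    case 4
    obtain a where a: "rightmost A a" using rightmost_exists[OF fin(1) 4(1) lines(1)] .
    obtain b where b: "rightmost B b" using rightmost_exists[OF fin(2) 4(2) lines(2)] .
    have mem: "a \<in> A" "b \<in> B" "a \<noteq> b" using a b disj by (auto simp: rightmost_def)
    let ?SC = "{M \<in> ?S. {a, b} \<in> M}"
    \<comment> \<open>If \<open>a\<close> and \<open>b\<close> both had partners on the opposite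
      line without being joined to each other, their segments would cross.\<close>
    have "?S \<subseteq> ?SA a \<union> ?SB b \<union> ?SC"
    proof
      fix M assume M: "M \<in> ?S"
      obtain x where x: "{a, x} \<in> M" using partner_exists[OF M, of a] mem by auto
      obtain y where y: "{b, y} \<in> M" using partner_exists[OF M, of b] mem by auto
      have False if *: "x \<in> B" "y \<in> A" "x \<noteq> b"
      proof -
        have "y \<noteq> a" using partner_unique[OF M, of a x b] x y * by (auto simp: insert_commute)
        then have "h y < h a" "h x < h b" using * a b by (auto simp: rightmost_def)
        moreover have "v a = v y" "v x = v b" using * mem lines by auto
        ultimately have "closed_segment a x \<inter> closed_segment y b \<noteq> {}"
          by (intro segments_cross) auto
        moreover have "{a, x} \<noteq> {y, b}" using \<open>y \<noteq> a\<close> mem by (auto simp: doubleton_eq_iff)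
        ultimately show False
          using disjoint_pairings_segments[OF M x, of y b] y by (simp add: insert_commute)
      qed
      then show "M \<in> ?SA a \<union> ?SB b \<union> ?SC"
        using x y M disjoint_pairings_mem[OF M x] disjoint_pairings_mem[OF M y] by blast
    qed
    then have S: "?S = ?SA a \<union> ?SB b \<union> ?SC" by blast
    \<comment> \<open>Partners are unique and the lines are disjoint, so joining \<open>a\<close> to
      \<open>b\<close> excludes both other classes.\<close>
    have "M \<notin> ?SA a \<and> M \<notin> ?SB b" if M: "M \<in> ?SC" for M
    proof -
      have "M \<in> ?S" "{a, b} \<in> M" "{b, a} \<in> M" using M by (auto simp: insert_commute)
      then show ?thesis using partner_unique[of M "A \<union> B"] mem disj by blast
    qed
    then have "card ?S = card (?SA a \<union> ?SB b) + card ?SC"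
      by (subst S, intro card_Un_disjoint) (use finS in auto)
    moreover have "card (?SA a) + card (?SB b) = card (?SA a \<union> ?SB b) + card (?SA a \<inter> ?SB b)"
      by (rule card_Un_Int) (use finS in auto)
    moreover have "card ?SC = num_comp_pairs (card A - 1) (card B - 1)"
    proof -
      have "?SC = insert {a, b} ` disjoint_pairings (A \<union> B - {a, b})"
        using mem rightmost_cross_separated[OF lines a b]
        by (intro disjoint_pairings_with_pair) auto
      then have "card ?SC = card (disjoint_pairings (A \<union> B - {a, b}))"
        using inj_on_insert_pair by (simp add: card_image)
      also have "A \<union> B - {a, b} = (A - {a}) \<union> (B - {b})" using mem disj by blast
      finally show ?thesis using IH[of "A - {a}" "B - {b}"] mem fin by (auto simp: card_Diff_singleton)
    qed
    moreover have "card (?SA a \<inter> ?SB b) =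
      (if card A < 2 \<or> card B < 2 then 0 else num_comp_pairs (card A - 2) (card B - 2))"
    proof (cases "card A < 2")
      case True
      then have "?SA a = {}" using SA[OF a] finS by simp
      then show ?thesis using True by (simp only: Int_empty_left card.empty simp_thms if_True)
    next
      case False
      obtain a' where a': "a' \<in> A" "a' \<noteq> a"
        and eq: "?SA a = insert {a, a'} ` disjoint_pairings (A - {a, a'} \<union> B)"
        using rightmost_within[OF fin lines a leI[OF False]] .
      let ?S' = "disjoint_pairings (B \<union> (A - {a, a'}))"
      have P: "A - {a, a'} \<union> B = A \<union> B - {a, a'}" using a' mem disj by blast
      have ne: "{b, x} \<noteq> {a, a'}" for x using mem a' disj by (auto simp: doubleton_eq_iff)
      \<comment> \<open>The pair of \<open>a\<close> and \<open>a'\<close> does not involve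
        \<open>b\<close>, so the condition on \<open>b\<close> can be tested on the pairing that
        remains once this pair is removed. The previous count then applies with the two lines
        exchanged.\<close>
      have "?SA a \<inter> ?SB b = {M \<in> ?SA a. \<exists>x\<in>B. {b, x} \<in> M}" by blast
      also have "\<dots> = insert {a, a'} ` {M \<in> ?S'. \<exists>x\<in>B. {b, x} \<in> M}"
        unfolding eq using ne by (auto simp: Un_commute)
      finally have "card (?SA a \<inter> ?SB b) = card {M \<in> ?S'. \<exists>x\<in>B. {b, x} \<in> M}"
        using inj_on_insert_pair[of a a' "A \<union> B"] P
        by (simp add: card_image inj_on_subset Un_commute)
      also have "\<dots> = (if card B < 2 then 0 else num_comp_pairs (card (A - {a, a'})) (card B - 2))"
      proof (rule card_rightmost_within[OF fin(2) _ lines(2) _ lines(3)[symmetric] b])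
        show "finite (A - {a, a'})" "A - {a, a'} \<subseteq> {x. v x = c}" using fin lines by auto
        fix B' assume "B' \<subset> B"
        then show "card (disjoint_pairings (B' \<union> (A - {a, a'}))) =
            num_comp_pairs (card (A - {a, a'})) (card B')"
          using IH[of "A - {a, a'}" B'] by (auto simp: Un_commute)
      qed
      also have "card (A - {a, a'}) = card A - 2"
        using a' mem fin by (simp add: card_Diff_subset)
      finally show ?thesis using False by simp
    qed
    moreover have "0 < card A" "0 < card B" using mem fin by (auto simp: card_gt_0_iff)
    ultimately show ?thesis
      using num_comp_pairs_step[of "card A" "card B"] SA[OF a] SB[OF b] by linarith
  qed
qed

end

section \<open>Coordinates adapted to two parallel lines\<close>

lemma orthogonal_pair_zero:
  fixes u w x :: "real ^ 2"
  assumes "u \<noteq> 0" "w \<noteq> 0" "orthogonal u w" "u \<bullet> x = 0" "w \<bullet> x = 0"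
  shows "x = 0"
proof (rule ccontr)
  assume x: "x \<noteq> 0"
  have *: "u \<bullet> w = 0" "w \<bullet> u = 0" "x \<bullet> u = 0" "x \<bullet> w = 0"
    using assms by (auto simp: orthogonal_def inner_commute)
  then have ne: "u \<noteq> w" "u \<noteq> x" "w \<noteq> x" using assms x by auto
  \<comment> \<open>Three nonzero pairwise orthogonal vectors would be independent, which the
    dimension of the plane forbids.\<close>
  have "independent {u, w, x}"
    by (rule pairwise_orthogonal_independent)
      (use * assms x in \<open>auto simp: pairwise_def orthogonal_def\<close>)
  then have "card {u, w, x} \<le> 2" using independent_card_le by fastforce
  then show False using ne by simp
qed

text \<open>Take for \<open>h\<close> and \<open>v\<close> the inner products with a direction
  vector \<open>u\<close> and a normal vector \<open>w\<close>. If the two heights agreed, the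
  translation \<open>a\<close> would run along the line and the lines would coincide.\<close>

lemma parallel_lines_coordinates:
  assumes "distinct_parallel_lines L1 L2"
  obtains h v c d where "line_coordinates h v" "L1 \<subseteq> {x. v x = c}" "L2 \<subseteq> {x. v x = d}" "c \<noteq> d"
proof -
  have L: "affine L1" "aff_dim L1 = 1" "affine_parallel L1 L2" "L1 \<noteq> L2"
    using assms by (auto simp: distinct_parallel_lines_def)
  obtain a where a: "L2 = (\<lambda>x. a + x) ` L1"
    using L(3) by (auto simp: affine_parallel_def)
  have "L1 \<noteq> {}" using L(2) by auto
  then obtain S where S: "subspace S" "affine_parallel L1 S"
    using affine_parallel_subspace[of L1] L(1) by auto
  then obtain p where L1: "L1 = (\<lambda>x. p + x) ` S"
    using affine_parallel_commute[of L1 S] by (auto simp: affine_parallel_def)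
  have dimS: "dim S = 1"
    using S L(1,2) aff_dim_parallel_eq[of L1 S] aff_dim_subspace[of S]
    by (simp add: hull_same subspace_imp_affine)
  then have "\<not> S \<subseteq> {0}" by (simp flip: dim_eq_0)
  then obtain u where u: "u \<in> S" "u \<noteq> 0" by blast
  obtain w where w: "w \<noteq> 0" "\<And>y. y \<in> span S \<Longrightarrow> orthogonal w y"
    using orthogonal_to_subspace_exists[of S] dimS by auto
  have wS: "w \<bullet> y = 0" if "y \<in> S" for y
    using w(2) that span_base by (metis orthogonal_def)
  have uw: "orthogonal u w" using wS u(1) by (simp add: orthogonal_def inner_commute)
  have zero: "x = 0" if "u \<bullet> x = 0" "w \<bullet> x = 0" for x
    using orthogonal_pair_zero u w uw that by blast
  have "line_coordinates ((\<bullet>) u) ((\<bullet>) w)"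
  proof (rule line_coordinates.intro)
    show "linear ((\<bullet>) u)" "linear ((\<bullet>) w)"
      by (simp_all add: bounded_linear.linear bounded_linear_inner_right)
    show "x = y" if "u \<bullet> x = u \<bullet> y" "w \<bullet> x = w \<bullet> y" for x y
      using zero[of "x - y"] that by (simp add: inner_diff_right)
  qed
  moreover have "L1 \<subseteq> {x. w \<bullet> x = w \<bullet> p}"
    using L1 wS by (auto simp: inner_add_right)
  moreover from this have "L2 \<subseteq> {x. w \<bullet> x = w \<bullet> a + w \<bullet> p}"
    by (auto simp: a inner_add_right)
  moreover have "w \<bullet> a \<noteq> 0"
  proof
    assume wa: "w \<bullet> a = 0"
    \<comment> \<open>The coefficient of the projection of \<open>a\<close> onto \<open>u\<close>:
      the remainder is orthogonal to \<open>u\<close>, and also to \<open>w\<close>, hence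
      zero.\<close>
    define t where "t = (u \<bullet> a) / (u \<bullet> u)"
    have "a - t *\<^sub>R u = 0"
      using u wa wS[OF u(1)] by (intro zero) (simp_all add: t_def inner_diff_right)
    then have aS: "a \<in> S" using S(1) u(1) by (simp add: subspace_scale)
    have "(\<lambda>x. a + x) ` S = S"
    proof (intro set_eqI iffI)
      fix x assume "x \<in> S"
      then have "x - a \<in> S" using aS S(1) by (simp add: subspace_diff)
      then show "x \<in> (\<lambda>x. a + x) ` S" by (intro image_eqI[of _ _ "x - a"]) auto
    qed (use subspace_add[OF S(1) aS] in auto)
    moreover have "L2 = (\<lambda>x. p + x) ` (\<lambda>x. a + x) ` S"
      by (simp add: a L1 image_image add.left_commute)
    ultimately have "L2 = L1" by (simp only: L1)
    then show False using L(4) by simp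
  qed
  ultimately show thesis
    using that[of "(\<bullet>) u" "(\<bullet>) w" "w \<bullet> p" "w \<bullet> a + w \<bullet> p"] by simp
qed

theorem mainTheorem5:
  fixes k n s :: nat and L1 L2 A B :: "(real ^ 2) set"
  assumes "distinct_parallel_lines L1 L2"
    and "A \<subseteq> L1" and "finite A" and "card A = k"
    and "B \<subseteq> L2" and "finite B" and "card B = n"
    and "even k \<longleftrightarrow> even n" and "k \<le> n" and "s = (n - k) div 2"
  shows "num_disjoint_pairings A B =
    card {(c1, c2). c1 \<in> compositions (k + 2) \<and> (\<forall>x\<in>set c1. 2 \<le> x) \<and>
                    c2 \<in> compositions (n + 2) \<and> (\<forall>x\<in>set c2. 2 \<le> x) \<and>
                    length c2 = length c1 + s}"
proof -
  obtain h v c d where "line_coordinates h v"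
    and lines: "L1 \<subseteq> {x. v x = c}" "L2 \<subseteq> {x. v x = d}" "c \<noteq> d"
    using parallel_lines_coordinates[OF assms(1)] .
  then interpret line_coordinates h v by simp
  have "num_disjoint_pairings A B = num_comp_pairs k n"
    using card_disjoint_pairings[of A B c d] assms lines
    by (simp add: num_disjoint_pairings_def disjoint_pairings_def subset_trans)
  \<comment> \<open>Equal parity makes the division by \<open>2\<close> exact, and
    \<open>k \<le> n\<close> keeps the subtraction from being truncated.\<close>
  moreover have "n = k + 2 * s" using assms(8-10) by presburger
  ultimately show ?thesis by (simp only: card_comp_pairs)
qed

end
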